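(* Let $\mathcal{Z}_N=\{Z^{(1)},\dots,Z^{(N)}\}\subset\mathcal{Z}$ be a given dataset and $\mathbb{P}_N=\sum_{i=1}^N\mu_i\boldsymbol{\chi}_{\{Z^{(i)}\}}\in\mathcal{P}(\mathcal{Z})$ the corresponding empirical distribution, where $\mu_i\ge 0$ and $\sum_{i=1}^N\mu_i=1$. Let $d(\cdot,\cdot)$ be a cost function on $\mathcal{Z}\times\mathcal{Z}$ and $\delta\in(0,\infty)$. Let $r\in(1,\infty)$, let $\mathcal{B}$ be a set, suppose the loss function $\ell:\mathcal{Z}\times\mathcal{B}\to\mathbb{R}$ has the form $\ell(z;\beta)=\psi_\beta^r(z)$, and fix $\beta\in\mathcal{B}$ such that $\psi_\beta:\mathcal{Z}\to\mathbb{R}_+=[0,\infty)$ satisfies: (A1) $\psi_\beta$ is $(L_\beta^{\mathcal{Z}_N},d)$-Lipschitz at $\mathcal{Z}_N$ with $L_\beta^{\mathcal{Z}_N}\in(0,\infty)$; (B) for any $\epsilon\in(0,L_\beta^{\mathcal{Z}_N})$ and $Z^{(i)}\in\mathcal{Z}_N$, there exists $\tilde Z^{(i)}_\epsilon\in\mathcal{Z}$ such that $d(\tilde Z^{(i)}_\epsilon,Z^{(i)})\in\mathcal{D}(Z^{(i)})$ and $$\psi_\beta(\tilde Z^{(i)}_\epsilon)-\psi_\beta(Z^{(i)})\ge(L_\beta^{\mathcal{Z}_N}-\epsilon)\,d(\tilde Z^{(i)}_\epsilon,Z^{(i)}),$$ where the set $\mathcal{D}(Z^{(i)})\subset\mathbb{R}$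 is defined as $$\mathcal{D}(Z^{(i)})=\begin{cases}\left\{\dfrac{\psi_\beta(Z^{(i)})}{(\mathrm{E}_{\mathbb{P}_N}[\ell(Z;\beta)])^{1/r}}\,\delta\right\}&\text{if }\mathrm{E}_{\mathbb{P}_N}[\ell(Z;\beta)]\neq0,\\[2mm] [\delta,\infty)&\text{if }\mathrm{E}_{\mathbb{P}_N}[\ell(Z;\beta)]=0.\end{cases}$$ Then $$\sup_{\mathbb{P}\in\mathcal{P}(\mathcal{Z}):\ \mathcal{W}_{d,r}(\mathbb{P},\mathbb{P}_N)\le\delta}\mathrm{E}_{\mathbb{P}}[\ell(Z;\beta)]=\Big(\big(\mathrm{E}_{\mathbb{P}_N}[\ell(Z;\beta)]\big)^{1/r}+L_\beta^{\mathcal{Z}_N}\delta\Big)^r.$$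
   Context: $\mathcal{Z}$ is a measurable space in which every singleton $\{z\}$ is measurable; $\mathcal{Z}\times\mathcal{Z}$ carries the product $\sigma$-algebra; $\mathcal{P}(\mathcal{Z})$ is the set of probability measures on $\mathcal{Z}$; $\boldsymbol{\chi}_{\{\hat z\}}$ is the Dirac measure at $\hat z$; $\mathrm{E}_{\mathbb{P}}[f(Z)]=\int_{\mathcal{Z}}f\,\mathrm{d}\mathbb{P}$. Standing assumption: $\ell(\cdot;\beta)$ is measurable for every $\beta\in\mathcal{B}$. Convention: $0\cdot\infty=0$. Cost function: a measurable function $d:\mathcal{Z}\times\mathcal{Z}\to[0,\infty]$ with $d(z,z)=0$ for all $z\in\mathcal{Z}$ (no symmetry, triangle inequality or positive definiteness required). Wasserstein discrepancy: for $\mathbb{P},\mathbb{Q}\in\mathcal{P}(\mathcal{Z})$, $\mathcal{W}_{d,r}(\mathbb{P},\mathbb{Q})=\big(\inf_{\pi\in\Pi(\mathbb{P},\mathbb{Q})}\int_{\mathcal{Z}\times\mathcal{Z}}d^r(z',z)\,\mathrm{d}\pi(z',z)\big)^{1/r}$, where $\Pi(\mathbb{P},\mathbb{Q})$ is the set of probability measures $\pi$ on $\mathcal{Z}\times\mathcal{Z}$ with first marginal $\mathbb{P}$ and second marginal $\mathbb{Q}$. Weak Lipschitz property: for $f:\mathcal{Z}\to\mathbb{R}$, $S\subset\mathcal{Z}$ and a constant $L\in[0,\infty)$, $f$ is called $(L,d)$-Lipschitz at $S$ if $|f(z')-f(z)|\le L\,d(z',z)$ for all $z\in S$ and $z'\in\mathcal{Z}$.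 *)

theory Defs
  imports "HOL-Probability.Probability"
begin

text \<open>
  The power \<open>x\<^sup>a\<close> on \<open>[0, \<infinity>]\<close> with \<open>\<infinity>\<^sup>a = \<infinity>\<close>. It is only meant for \<open>a > 0\<close>.
\<close>

definition ennreal_powr :: "ennreal \<Rightarrow> real \<Rightarrow> ennreal" where
  "ennreal_powr x a = (if x = \<infinity> then \<infinity> else ennreal (enn2real x powr a))"

text \<open>
  \<open>E\<^sub>P[f]\<close> for a nonnegative \<open>f\<close>, as an extended real: it is \<open>\<infinity>\<close>, and not \<open>0\<close>, when \<open>f\<close> is
  not integrable. Only meant for \<open>f \<ge> 0\<close> (\<open>ennreal\<close> truncates negative values to \<open>0\<close>).
\<close>

definition nn_expectation :: "'a measure \<Rightarrow> ('a \<Rightarrow> real) \<Rightarrow> ennreal" where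
  "nn_expectation P f = (\<integral>\<^sup>+ z. ennreal (f z) \<partial>P)"

definition cost_function :: "'a measure \<Rightarrow> ('a \<Rightarrow> 'a \<Rightarrow> ennreal) \<Rightarrow> bool" where
  "cost_function M d \<longleftrightarrow>
     (\<lambda>(z', z). d z' z) \<in> borel_measurable (M \<Otimes>\<^sub>M M) \<and> (\<forall>z\<in>space M. d z z = 0)"

definition couplings :: "'a measure \<Rightarrow> 'a measure \<Rightarrow> ('a \<times> 'a) measure set" where
  "couplings P Q =
     {\<pi> \<in> space (prob_algebra (P \<Otimes>\<^sub>M Q)). distr \<pi> P fst = P \<and> distr \<pi> Q snd = Q}"

definition wasserstein ::
  "('a \<Rightarrow> 'a \<Rightarrow> ennreal) \<Rightarrow> real \<Rightarrow> 'a measure \<Rightarrow> 'a measure \<Rightarrow> ennreal" where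
  "wasserstein d r P Q =
     ennreal_powr (INF \<pi>\<in>couplings P Q. \<integral>\<^sup>+ (z', z). ennreal_powr (d z' z) r \<partial>\<pi>) (1 / r)"

text \<open>
  The inequality is read in \<open>[0, \<infinity>]\<close>, where \<open>0 * \<infinity> = 0\<close>. Since \<open>d\<close> need not be symmetric, the
  order of its arguments matters: the point of \<open>S\<close> is the second one.
\<close>

definition lipschitz_at ::
  "'a measure \<Rightarrow> real \<Rightarrow> ('a \<Rightarrow> 'a \<Rightarrow> ennreal) \<Rightarrow> 'a set \<Rightarrow> ('a \<Rightarrow> real) \<Rightarrow> bool" where
  "lipschitz_at M L d S f \<longleftrightarrow>
     0 \<le> L \<and> (\<forall>z\<in>S. \<forall>z'\<in>space M. ennreal \<bar>f z' - f z\<bar> \<le> ennreal L * d z' z)"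

text \<open>The weighted sum \<open>\<Sum>\<^sub>i \<mu>\<^sub>i \<delta>(Z\<^sub>i)\<close> over \<open>i = 1, \<dots>, N\<close> of the Dirac measures \<open>return M (Z i)\<close>.\<close>

definition empirical :: "'a measure \<Rightarrow> nat \<Rightarrow> (nat \<Rightarrow> real) \<Rightarrow> (nat \<Rightarrow> 'a) \<Rightarrow> 'a measure" where
  "empirical M N \<mu> Z =
     measure_of (space M) (sets M)
       (\<lambda>A. \<Sum>i\<in>{1..N}. ennreal (\<mu> i) * emeasure (return M (Z i)) A)"

lemma space_empirical [simp]: "space (empirical M N \<mu> Z) = space M"
  by (simp add: empirical_def space_measure_of_conv)

lemma sets_empirical [simp, measurable_cong]: "sets (empirical M N \<mu> Z) = sets M"
  by (simp add: empirical_def)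

lemma emeasure_empirical:
  assumes "A \<in> sets M"
  shows "emeasure (empirical M N \<mu> Z) A =
    (\<Sum>i\<in>{1..N}. ennreal (\<mu> i) * emeasure (return M (Z i)) A)"
proof (rule emeasure_measure_of[OF empirical_def])
  show "countably_additive (sets (empirical M N \<mu> Z))
     (\<lambda>A. \<Sum>i\<in>{1..N}. ennreal (\<mu> i) * emeasure (return M (Z i)) A)"
  proof (rule countably_additiveI)
    fix A :: "nat \<Rightarrow> 'a set"
    assume A: "range A \<subseteq> sets (empirical M N \<mu> Z)" "disjoint_family A"
    have "(\<Sum>k. \<Sum>i\<in>{1..N}. ennreal (\<mu> i) * emeasure (return M (Z i)) (A k)) =
      (\<Sum>i\<in>{1..N}. \<Sum>k. ennreal (\<mu> i) * emeasure (return M (Z i)) (A k))"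
      by (rule suminf_sum) simp
    also have "\<dots> = (\<Sum>i\<in>{1..N}. ennreal (\<mu> i) * emeasure (return M (Z i)) (\<Union> (range A)))"
      using A by (intro sum.cong refl) (simp add: suminf_emeasure del: emeasure_return)
    finally show "(\<Sum>k. \<Sum>i\<in>{1..N}. ennreal (\<mu> i) * emeasure (return M (Z i)) (A k)) =
      (\<Sum>i\<in>{1..N}. ennreal (\<mu> i) * emeasure (return M (Z i)) (\<Union> (range A)))" .
  qed
qed (use assms sets.space_closed in \<open>auto simp: positive_def\<close>)

lemma empirical_in_prob_algebra:
  assumes "\<And>i. i \<in> {1..N} \<Longrightarrow> Z i \<in> space M" "\<And>i. i \<in> {1..N} \<Longrightarrow> 0 \<le> \<mu> i"
    and "(\<Sum>i\<in>{1..N}. \<mu> i) = 1"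
  shows "empirical M N \<mu> Z \<in> space (prob_algebra M)"
proof -
  have "emeasure (empirical M N \<mu> Z) (space M) = (\<Sum>i\<in>{1..N}. ennreal (\<mu> i))"
    unfolding emeasure_empirical[OF sets.top]
    by (intro sum.cong refl) (simp add: assms(1))
  also have "\<dots> = ennreal (\<Sum>i\<in>{1..N}. \<mu> i)"
    by (rule sum_ennreal) (use assms(2) in blast)
  finally have "emeasure (empirical M N \<mu> Z) (space M) = 1"
    by (simp only: assms(3) ennreal_1)
  then show ?thesis
    by (simp add: space_prob_algebra prob_spaceI)
qed

text \<open>
  The set \<open>\<D>(z)\<close> of the growth condition as a subset of \<open>[0, \<infinity>) \<subseteq> [0, \<infinity>]\<close>, for \<open>\<psi> \<ge> 0\<close> and
  \<open>E = E\<^sub>P[\<psi>\<^sup>r]\<close> finite: the upper bound \<open>\<infinity>\<close> of the interval in the second case is excluded.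
\<close>

definition growth_distances ::
  "ennreal \<Rightarrow> real \<Rightarrow> real \<Rightarrow> ('a \<Rightarrow> real) \<Rightarrow> 'a \<Rightarrow> ennreal set" where
  "growth_distances E r \<delta> \<psi> z =
     (if E \<noteq> 0 then {ennreal (\<psi> z) / ennreal_powr E (1 / r) * ennreal \<delta>}
      else {ennreal \<delta>..<\<infinity>})"

end

theory Submission
  imports Defs
begin

text \<open>
  Upper bound: along any coupling of \<open>P\<close> with the empirical distribution,
  \<open>\<psi>(z') \<le> \<psi>(z) + L d(z', z)\<close> almost surely, and the claim is Minkowski's inequality in \<open>L\<^sup>r\<close>.
  The latter comes from convexity of \<open>x\<^sup>r\<close>, in a form that only needs upper bounds on the two
  norms, so that a nearly optimal coupling suffices.

  Lower bound: if the empirical loss is positive, move every atom \<open>Z\<^sub>i\<close> to the point given by the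
  growth condition; the prescribed distances are proportional to \<open>\<psi>(Z\<^sub>i)\<close>, which is the equality
  case of Minkowski's inequality. If it is zero, the points are at distances \<open>D\<^sub>i \<ge> \<delta>\<close>, and moving
  only the fraction \<open>(\<delta> / D\<^sub>i)\<^sup>r\<close> of the mass of \<open>Z\<^sub>i\<close> exhausts the budget \<open>\<delta>\<close> exactly.
\<close>

section \<open>A pointwise form of Minkowski's inequality\<close>

text \<open>
  For \<open>A = \<parallel>a\<parallel>\<close> and \<open>B = \<parallel>b\<parallel>\<close> the norms of functions \<open>a\<close> and \<open>b\<close> in \<open>L\<^sup>r\<close>, integrating this inequality
  gives Minkowski's inequality.
\<close>

lemma powr_add_le_weighted:
  fixes a b A B r :: real
  assumes r: "1 \<le> r" and ab: "0 \<le> a" "0 \<le> b" and AB: "0 < A" "0 < B"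
  shows "(a + b) powr r \<le> (A + B) powr (r - 1) * (A powr (1 - r) * a powr r + B powr (1 - r) * b powr r)"
proof -
  \<comment> \<open>Settles the cases where \<open>a\<close> or \<open>b\<close> vanishes: one
    summand is enough, since (X + Y)^(r - 1) \<ge> X^(r - 1).\<close>
  have bound: "x powr r \<le> (X + Y) powr (r - 1) * (X powr (1 - r) * x powr r)"
    if "0 < X" "0 < Y" for x X Y :: real
  proof -
    have "1 = X powr (r - 1) * X powr (1 - r)"
      using that by (simp flip: powr_add)
    also have "\<dots> \<le> (X + Y) powr (r - 1) * X powr (1 - r)"
      using that r by (intro mult_right_mono powr_mono2) auto
    finally show ?thesis
      by (metis mult.assoc mult_1 mult_right_mono powr_ge_zero)
  qed
  consider "a = 0" | "b = 0" | "0 < a" "0 < b"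
    using ab by fastforce
  then show ?thesis
  proof cases
    case 1
    then show ?thesis using bound[of B A b] AB r by (simp add: add.commute)
  next
    case 2
    then show ?thesis using bound[of A B a] AB r by simp
  next
    case 3
    define C where "C = A + B"
    have C: "0 < C" using AB by (simp add: C_def)
    have rescale: "X / C * (x / X) powr r * C powr r = C powr (r - 1) * (X powr (1 - r) * x powr r)"
      if "0 < X" "0 < x" for x X
      using that C by (simp add: powr_divide powr_diff divide_simps)
    have "1 - B / C = A / C"
      using C by (simp add: C_def field_simps)
    then have "A / C * (a / A) + B / C * (b / B) = (a + b) / C"
      using AB by (simp add: add_divide_distrib)
    \<comment> \<open>Convexity of x^r, with (a + b) / C seen as the mean of a / A and b / B with
      weights A / C and B / C. Multiplying by C^r then gives the claim.\<close>
    then have "((a + b) / C) powr r \<le> A / C * (a / A) powr r + B / C * (b / B) powr r"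
      using convex_onD[OF powr_convex[OF r], of "B / C" "a / A" "b / B"] 3 AB C \<open>1 - B / C = A / C\<close>
      by (simp add: C_def)
    then have "((a + b) / C) powr r * C powr r \<le> (A / C * (a / A) powr r + B / C * (b / B) powr r) * C powr r"
      by (rule mult_right_mono) simp
    also have "\<dots> = C powr (r - 1) * (A powr (1 - r) * a powr r + B powr (1 - r) * b powr r)"
      unfolding distrib_right[of _ _ "C powr r"] rescale[OF AB(1) 3(1)] rescale[OF AB(2) 3(2)]
      by (simp add: algebra_simps)
    finally show ?thesis
      using C 3 by (simp add: C_def powr_divide)
  qed
qed

section \<open>Powers of extended nonnegative reals\<close>

lemma ennreal_powr_ennreal: "0 \<le> x \<Longrightarrow> ennreal_powr (ennreal x) a = ennreal (x powr a)"
  by (simp add: ennreal_powr_def)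

lemma ennreal_powr_mono:
  assumes "x \<le> y" "0 \<le> a"
  shows "ennreal_powr x a \<le> ennreal_powr y a"
proof (cases "y = \<infinity>")
  case False
  then have "y < \<infinity>" by (simp add: less_top)
  then have "enn2real x powr a \<le> enn2real y powr a" "x \<noteq> \<infinity>"
    using assms by (auto intro!: powr_mono2 enn2real_mono simp: top_unique)
  then show ?thesis
    using False by (simp add: ennreal_powr_def ennreal_leI)
qed (simp add: ennreal_powr_def)

text \<open>Used to undo the root 1 / r in the definition of \<open>wasserstein\<close>.\<close>

lemma ennreal_powr_powr:
  assumes "a * b = 1"
  shows "ennreal_powr (ennreal_powr x a) b = x"
  using assms by (cases x) (simp_all add: ennreal_powr_ennreal powr_powr, simp add: ennreal_powr_def)

lemma borel_measurable_ennreal_powr [measurable (raw)]: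
  assumes [measurable]: "f \<in> borel_measurable M"
  shows "(\<lambda>x. ennreal_powr (f x) a) \<in> borel_measurable M"
  unfolding ennreal_powr_def by measurable

section \<open>Finitely supported measures and their transport cost\<close>

text \<open>Finitely supported measures are handled as images of a \<open>point_measure\<close> on
  the index set. The weights sit on indices, so coinciding points need no separate
  treatment.\<close>

lemma nn_integral_distr_point_measure:
  assumes "finite I" "x \<in> I \<rightarrow> space M" "f \<in> borel_measurable M"
  shows "(\<integral>\<^sup>+ z. f z \<partial>distr (point_measure I w) M x) = (\<Sum>i\<in>I. w i * f (x i))"
  using assms by (simp add: nn_integral_distr nn_integral_point_measure_finite)

lemma distr_point_measure_in_prob_algebra:
  assumes "finite I" "x \<in> I \<rightarrow> space M" "(\<Sum>i\<in>I. w i) = 1"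
  shows "distr (point_measure I w) M x \<in> space (prob_algebra M)"
proof -
  have "emeasure (point_measure I w) (space (point_measure I w)) = 1"
    using assms by (simp add: emeasure_point_measure_finite space_point_measure)
  then have "prob_space (point_measure I w)"
    by (rule prob_spaceI)
  then show ?thesis
    using assms by (auto simp: space_prob_algebra intro!: prob_space.prob_space_distr)
qed

lemma empirical_eq_distr:
  assumes "Z \<in> {1..N} \<rightarrow> space M"
  shows "empirical M N \<mu> Z = distr (point_measure {1..N} (\<lambda>i. ennreal (\<mu> i))) M Z"
proof (rule measure_eqI)
  fix A assume "A \<in> sets (empirical M N \<mu> Z)"
  then have A: "A \<in> sets M" by simp
  have "emeasure (distr (point_measure {1..N} (\<lambda>i. ennreal (\<mu> i))) M Z) A =
      (\<integral>\<^sup>+ z. indicator A z \<partial>distr (point_measure {1..N} (\<lambda>i. ennreal (\<mu> i))) M Z)"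
    using A by simp
  also have "\<dots> = (\<Sum>i\<in>{1..N}. ennreal (\<mu> i) * indicator A (Z i))"
    using A assms by (subst nn_integral_distr_point_measure) auto
  finally show "emeasure (empirical M N \<mu> Z) A =
      emeasure (distr (point_measure {1..N} (\<lambda>i. ennreal (\<mu> i))) M Z) A"
    using A by (simp add: emeasure_empirical)
qed simp

text \<open>The Lipschitz bound is available only at data points. Measurable singletons make the
  finite dataset a measurable set, so that its full measure can be transferred to a
  coupling.\<close>

lemma AE_empirical_in_image:
  assumes "\<And>z. z \<in> space M \<Longrightarrow> {z} \<in> sets M" "Z \<in> {1..N} \<rightarrow> space M"
  shows "Z ` {1..N} \<in> sets M" "AE z in empirical M N \<mu> Z. z \<in> Z ` {1..N}"
proof -
  have "(\<Union>i\<in>{1..N}. {Z i}) \<in> sets M"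
    using assms(1) funcset_mem[OF assms(2)] by (intro sets.finite_UN) auto
  then show S: "Z ` {1..N} \<in> sets M"
    by (simp add: UNION_singleton_eq_range)
  have "AE i in point_measure {1..N} (\<lambda>i. ennreal (\<mu> i)). Z i \<in> Z ` {1..N}"
    by (auto simp: AE_point_measure)
  then show "AE z in empirical M N \<mu> Z. z \<in> Z ` {1..N}"
    unfolding empirical_eq_distr[OF assms(2)] using assms(2) S
    by (subst AE_distr_iff) (auto simp: sets.sets_into_space Int_absorb1)
qed

lemma borel_measurable_cost_powr:
  assumes "cost_function M d"
  shows "(\<lambda>(z', z). ennreal_powr (d z' z) r) \<in> borel_measurable (M \<Otimes>\<^sub>M M)"
proof -
  have [measurable]: "(\<lambda>p. d (fst p) (snd p)) \<in> borel_measurable (M \<Otimes>\<^sub>M M)"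
    using assms by (simp add: cost_function_def case_prod_beta')
  show ?thesis
    unfolding case_prod_beta' by measurable
qed

text \<open>Two images of one measure on \<open>I\<close> are coupled by its image under the pair
  map, which sends the mass at \<open>x i\<close> to \<open>y i\<close>. The infimum is at most the
  cost of this coupling.\<close>

lemma wasserstein_distr_point_measure_le:
  fixes I :: "'i set"
  assumes I: "finite I" and xy: "x \<in> I \<rightarrow> space M" "y \<in> I \<rightarrow> space M"
    and w: "(\<Sum>i\<in>I. w i) = 1" and d: "cost_function M d" and r: "0 < r"
  shows "wasserstein d r (distr (point_measure I w) M x) (distr (point_measure I w) M y) \<le>
    ennreal_powr (\<Sum>i\<in>I. w i * ennreal_powr (d (x i) (y i)) r) (1 / r)"
proof -
  let ?P = "distr (point_measure I w) M x" and ?Q = "distr (point_measure I w) M y"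
  let ?\<pi> = "distr (point_measure I w) (M \<Otimes>\<^sub>M M) (\<lambda>i. (x i, y i))"
  have xy': "(\<lambda>i. (x i, y i)) \<in> I \<rightarrow> space (M \<Otimes>\<^sub>M M)"
    using xy by (auto simp: space_pair_measure)
  \<comment> \<open>\<open>couplings\<close> refers to the product of the two marginals; only its
    sigma-algebra matters, and that is the one of the square of \<open>M\<close>.\<close>
  have "sets (?P \<Otimes>\<^sub>M ?Q) = sets (M \<Otimes>\<^sub>M M)"
    by (intro sets_pair_measure_cong) simp_all
  then have "space (prob_algebra (?P \<Otimes>\<^sub>M ?Q)) = space (prob_algebra (M \<Otimes>\<^sub>M M))"
    by (simp add: space_prob_algebra)
  moreover have "distr ?\<pi> ?P fst = ?P" "distr ?\<pi> ?Q snd = ?Q"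
    using xy' by (auto simp: distr_distr comp_def intro!: distr_cong)
  ultimately have "?\<pi> \<in> couplings ?P ?Q"
    using distr_point_measure_in_prob_algebra[OF I xy' w] by (simp add: couplings_def)
  then have "(INF \<pi>\<in>couplings ?P ?Q. \<integral>\<^sup>+ (z', z). ennreal_powr (d z' z) r \<partial>\<pi>) \<le>
      (\<integral>\<^sup>+ (z', z). ennreal_powr (d z' z) r \<partial>?\<pi>)"
    by (rule INF_lower)
  also have "\<dots> = (\<Sum>i\<in>I. w i * ennreal_powr (d (x i) (y i)) r)"
    by (subst nn_integral_distr_point_measure[OF I xy' borel_measurable_cost_powr[OF d]]) simp
  finally show ?thesis
    unfolding wasserstein_def using r by (intro ennreal_powr_mono) auto
qed

section \<open>The upper bound\<close>

text \<open>The weighted inequality for the summands \<open>a\<close> and \<open>L * D\<close>, with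
  norms \<open>A\<close> and \<open>L * B\<close>. Here \<open>a\<close> and \<open>c\<close> stand
  for the values of \<psi> at the data point and at the transported point, and \<open>D\<close> for
  their distance.\<close>

lemma ennreal_powr_le_of_lipschitz:
  fixes L a c A B r :: real
  assumes r: "1 \<le> r" and L: "0 < L" and ac: "0 \<le> a" "0 \<le> c" and AB: "0 < A" "0 < B"
    and le: "ennreal \<bar>c - a\<bar> \<le> ennreal L * D"
  shows "ennreal (c powr r) \<le> ennreal ((A + L * B) powr (r - 1)) *
    (ennreal (A powr (1 - r)) * ennreal (a powr r) + ennreal (L * B powr (1 - r)) * ennreal_powr D r)"
proof (cases D)
  case (real x)
  have "c \<le> a + L * x"
    using le L real by (simp flip: ennreal_mult)
  then have "c powr r \<le> (a + L * x) powr r"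
    using r ac by (intro powr_mono2) auto
  also have "\<dots> \<le> (A + L * B) powr (r - 1) * (A powr (1 - r) * a powr r + (L * B) powr (1 - r) * (L * x) powr r)"
    using r L ac AB real by (intro powr_add_le_weighted) auto
  also have "(L * B) powr (1 - r) * (L * x) powr r = L * B powr (1 - r) * x powr r"
    using L AB real by (simp add: powr_mult powr_diff)
  finally show ?thesis
    using real L by (simp add: ennreal_powr_ennreal ennreal_leI flip: ennreal_mult ennreal_plus)
next
  case top
  \<comment> \<open>At infinite distance the right-hand side is infinite, because the coefficients
    in front of it are positive.\<close>
  have "0 < A + L * B"
    using AB L by (simp add: add_pos_pos)
  then have "ennreal (L * B powr (1 - r)) \<noteq> 0" "ennreal ((A + L * B) powr (r - 1)) \<noteq> 0"
    using AB L by (auto simp: ennreal_eq_0_iff not_le)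
  then show ?thesis
    using top by (simp add: ennreal_powr_def ennreal_mult_top ennreal_top_mult)
qed

lemma couplings_sets:
  assumes "\<pi> \<in> couplings P Q" "sets P = sets M" "sets Q = sets M"
  shows "sets \<pi> = sets (M \<Otimes>\<^sub>M M)"
  using assms sets_pair_measure_cong[of P M Q M] by (simp add: couplings_def space_prob_algebra)

text \<open>Integrates the pointwise inequality along the coupling. \<open>A\<close> and
  \<open>B\<close> are only positive upper bounds for the norms of \<open>f\<close> and of the cost,
  so the norms themselves may vanish.\<close>

lemma couplings_nn_integral_le:
  assumes P: "sets P = sets M" and Q: "sets Q = sets M" and d: "cost_function M d"
    and f: "\<And>z. z \<in> space M \<Longrightarrow> 0 \<le> f z" "(\<lambda>z. f z powr r) \<in> borel_measurable M"
    and r: "1 \<le> r" and L: "0 < L" and S: "S \<in> sets M" "AE z in Q. z \<in> S"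
    and lip: "lipschitz_at M L d S f" and \<pi>: "\<pi> \<in> couplings P Q" and AB: "0 < A" "0 < B"
    and le: "nn_expectation Q (\<lambda>z. f z powr r) \<le> ennreal (A powr r)"
      "(\<integral>\<^sup>+ (z', z). ennreal_powr (d z' z) r \<partial>\<pi>) \<le> ennreal (B powr r)"
  shows "nn_expectation P (\<lambda>z. f z powr r) \<le> ennreal ((A + L * B) powr r)"
proof -
  note sets_\<pi> [measurable_cong] = couplings_sets[OF \<pi> P Q]
  note [measurable_cong] = P Q
  have space_\<pi>: "space \<pi> = space M \<times> space M"
    using sets_eq_imp_space_eq[OF sets_\<pi>] by (simp add: space_pair_measure)
  note [measurable] = f(2) S(1)
  have [measurable]: "(\<lambda>p. ennreal_powr (d (fst p) (snd p)) r) \<in> borel_measurable (M \<Otimes>\<^sub>M M)"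
    using borel_measurable_cost_powr[OF d] by (simp add: case_prod_beta')
  have marginals: "distr \<pi> P fst = P" "distr \<pi> Q snd = Q"
    using \<pi> by (auto simp: couplings_def)
  have fst: "nn_expectation P (\<lambda>z. f z powr r) = (\<integral>\<^sup>+ p. ennreal (f (fst p) powr r) \<partial>\<pi>)"
    unfolding nn_expectation_def by (subst marginals(1)[symmetric], subst nn_integral_distr) measurable
  have snd: "nn_expectation Q (\<lambda>z. f z powr r) = (\<integral>\<^sup>+ p. ennreal (f (snd p) powr r) \<partial>\<pi>)"
    unfolding nn_expectation_def by (subst marginals(2)[symmetric], subst nn_integral_distr) measurable
  \<comment> \<open>Almost surely the second coordinate of the coupling is a data point, where the
    Lipschitz bound applies.\<close>
  have "AE z in distr \<pi> Q snd. z \<in> S"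
    unfolding marginals by (rule S(2))
  then have "AE p in \<pi>. snd p \<in> S"
    by (rule AE_distrD[rotated]) measurable
  then have "AE p in \<pi>. ennreal (f (fst p) powr r) \<le> ennreal ((A + L * B) powr (r - 1)) *
      (ennreal (A powr (1 - r)) * ennreal (f (snd p) powr r) +
       ennreal (L * B powr (1 - r)) * ennreal_powr (d (fst p) (snd p)) r)"
    using AE_space
  proof eventually_elim
    case (elim p)
    then show ?case
      using r L AB lip f(1) by (intro ennreal_powr_le_of_lipschitz) (auto simp: space_\<pi> lipschitz_at_def)
  qed
  then have "nn_expectation P (\<lambda>z. f z powr r) \<le>
      (\<integral>\<^sup>+ p. ennreal ((A + L * B) powr (r - 1)) *
      (ennreal (A powr (1 - r)) * ennreal (f (snd p) powr r) +
       ennreal (L * B powr (1 - r)) * ennreal_powr (d (fst p) (snd p)) r) \<partial>\<pi>)"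
    unfolding fst by (rule nn_integral_mono_AE)
  also have "\<dots> = ennreal ((A + L * B) powr (r - 1)) *
      (ennreal (A powr (1 - r)) * nn_expectation Q (\<lambda>z. f z powr r) +
       ennreal (L * B powr (1 - r)) * (\<integral>\<^sup>+ (z', z). ennreal_powr (d z' z) r \<partial>\<pi>))"
    unfolding snd by (simp add: nn_integral_cmult nn_integral_add case_prod_beta')
  also have "\<dots> \<le> ennreal ((A + L * B) powr (r - 1)) *
      (ennreal (A powr (1 - r)) * ennreal (A powr r) +
       ennreal (L * B powr (1 - r)) * ennreal (B powr r))"
    using le by (intro mult_left_mono add_mono) auto
  also have "\<dots> = ennreal ((A + L * B) powr (r - 1) * (A + L * B))"
  proof -
    \<comment> \<open>The weights are normalised so that the bracket becomes exactly
      \<open>A + L * B\<close>, which supplies the missing factor of the power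
      \<open>r\<close>.\<close>
    have "A powr (1 - r) * A powr r = A" "B powr (1 - r) * B powr r = B"
      using AB by (simp_all flip: powr_add)
    then show ?thesis
      using AB L by (simp add: mult.assoc flip: ennreal_mult ennreal_plus)
  qed
  also have "(A + L * B) powr (r - 1) * (A + L * B) = (A + L * B) powr r"
    using AB L by (simp add: powr_mult_base[symmetric] add_pos_pos powr_diff)
  finally show ?thesis .
qed

text \<open>The infimum over couplings need not be attained, and the norms may be zero. Both
  obstacles disappear after enlarging the two norm bounds by \<eta> > 0; then \<eta> tends to
  0.\<close>

lemma nn_expectation_le_of_wasserstein_le:
  assumes P: "sets P = sets M" and Q: "sets Q = sets M" and d: "cost_function M d"
    and f: "\<And>z. z \<in> space M \<Longrightarrow> 0 \<le> f z" "(\<lambda>z. f z powr r) \<in> borel_measurable M"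
    and r: "1 \<le> r" and L: "0 < L" and S: "S \<in> sets M" "AE z in Q. z \<in> S"
    and lip: "lipschitz_at M L d S f" and \<delta>: "0 \<le> \<delta>" and W: "wasserstein d r P Q \<le> ennreal \<delta>"
  shows "nn_expectation P (\<lambda>z. f z powr r) \<le>
    ennreal_powr (ennreal_powr (nn_expectation Q (\<lambda>z. f z powr r)) (1 / r) + ennreal (L * \<delta>)) r"
proof (cases "nn_expectation Q (\<lambda>z. f z powr r)")
  case (real e)
  have "(INF \<pi>\<in>couplings P Q. \<integral>\<^sup>+ (z', z). ennreal_powr (d z' z) r \<partial>\<pi>) \<le> ennreal (\<delta> powr r)"
    using ennreal_powr_mono[OF W, of r] r \<delta>
    by (simp add: wasserstein_def ennreal_powr_powr ennreal_powr_ennreal)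
  \<comment> \<open>The strict inequality yields a coupling whose cost is below the enlarged
    bound.\<close>
  also have "\<dots> < ennreal ((\<delta> + \<eta>) powr r)" if "0 < \<eta>" for \<eta>
    using that r \<delta> by (auto simp: ennreal_less_iff intro!: powr_less_mono2)
  finally have ex: "\<exists>\<pi>\<in>couplings P Q. (\<integral>\<^sup>+ (z', z). ennreal_powr (d z' z) r \<partial>\<pi>) < ennreal ((\<delta> + \<eta>) powr r)"
    if "0 < \<eta>" for \<eta>
    using that by (simp add: INF_less_iff)
  have approx: "nn_expectation P (\<lambda>z. f z powr r) \<le> ennreal ((e powr (1 / r) + \<eta> + L * (\<delta> + \<eta>)) powr r)"
    if \<eta>: "0 < \<eta>" for \<eta>
  proof -
    obtain \<pi> where \<pi>: "\<pi> \<in> couplings P Q"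
      "(\<integral>\<^sup>+ (z', z). ennreal_powr (d z' z) r \<partial>\<pi>) < ennreal ((\<delta> + \<eta>) powr r)"
      using ex[OF \<eta>] by blast
    have "e = (e powr (1 / r)) powr r"
      using real r by (simp add: powr_powr)
    also have "\<dots> \<le> (e powr (1 / r) + \<eta>) powr r"
      using r \<eta> by (intro powr_mono2) auto
    finally have "e \<le> (e powr (1 / r) + \<eta>) powr r" .
    then show ?thesis
      using \<pi> \<eta> \<delta> real by (intro couplings_nn_integral_le[OF P Q d f r L S lip])
        (auto intro: ennreal_leI add_nonneg_pos)
  qed
  \<comment> \<open>The base may tend to 0, so continuity of the power there rests on the positive
    exponent and on the base being nonnegative near the limit.\<close>
  have "((\<lambda>\<eta>. ennreal ((e powr (1 / r) + \<eta> + L * (\<delta> + \<eta>)) powr r)) \<longlongrightarrow>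
      ennreal ((e powr (1 / r) + 0 + L * (\<delta> + 0)) powr r)) (at_right 0)"
    using r L \<delta> by (intro tendsto_intros tendsto_powr')
      (auto simp: eventually_at_right_field intro!: exI[of _ 1])
  then have "nn_expectation P (\<lambda>z. f z powr r) \<le> ennreal ((e powr (1 / r) + 0 + L * (\<delta> + 0)) powr r)"
    by (rule tendsto_lowerbound) (auto simp: eventually_at_right_field approx intro!: exI[of _ 1])
  then show ?thesis
    using real L \<delta> by (simp add: ennreal_powr_ennreal flip: ennreal_plus)
qed (simp add: ennreal_powr_def)

section \<open>The lower bound: construction of nearly worst distributions\<close>

lemma sum_Times_UNIV_bool:
  fixes F :: "'i \<times> bool \<Rightarrow> 'c::comm_monoid_add"
  shows "(\<Sum>p\<in>A \<times> UNIV. F p) = (\<Sum>i\<in>A. F (i, True) + F (i, False))"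
  by (subst sum.cartesian_product') (simp add: UNIV_bool add.commute)

text \<open>The witness moves the fraction \<open>q i\<close> of the mass of \<open>Z i\<close> to \<open>x i\<close>.\<close>

lemma ex_wasserstein_empirical_le:
  assumes Z: "Z \<in> {1..N} \<rightarrow> space M" and x: "x \<in> {1..N} \<rightarrow> space M"
    and \<mu>: "\<And>i. i \<in> {1..N} \<Longrightarrow> 0 \<le> \<mu> i" "(\<Sum>i\<in>{1..N}. \<mu> i) = 1"
    and q: "\<And>i. i \<in> {1..N} \<Longrightarrow> 0 \<le> q i" "\<And>i. i \<in> {1..N} \<Longrightarrow> q i \<le> 1"
    and D: "\<And>i. i \<in> {1..N} \<Longrightarrow> 0 \<le> D i" "\<And>i. i \<in> {1..N} \<Longrightarrow> d (x i) (Z i) = ennreal (D i)"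
    and d: "cost_function M d" and r: "0 < r" and \<delta>: "0 \<le> \<delta>"
    and cost: "(\<Sum>i\<in>{1..N}. \<mu> i * q i * D i powr r) \<le> \<delta> powr r"
    and g: "g \<in> borel_measurable M" "\<And>z. z \<in> space M \<Longrightarrow> 0 \<le> g z"
  shows "\<exists>P\<in>space (prob_algebra M). wasserstein d r P (empirical M N \<mu> Z) \<le> ennreal \<delta> \<and>
    ennreal (\<Sum>i\<in>{1..N}. \<mu> i * q i * g (x i)) \<le> nn_expectation P g"
proof -
  \<comment> \<open>Each atom is split in two: the flag \<open>True\<close> marks the part that
    moves to \<open>x i\<close>, \<open>False\<close> the part that stays at \<open>Z i\<close>.
    \<open>X\<close> and \<open>Y\<close> give the positions after and before the move, so the
    common index couples the two distributions.\<close>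
  define I :: "(nat \<times> bool) set" where "I = {1..N} \<times> UNIV"
  define w where "w = (\<lambda>(i, b). ennreal (\<mu> i * (if b then q i else 1 - q i)))"
  define X where "X = (\<lambda>(i, b). if b then x i else Z i)"
  define Y :: "nat \<times> bool \<Rightarrow> 'a" where "Y = Z \<circ> fst"
  define P where "P = distr (point_measure I w) M X"
  have I: "finite I" by (simp add: I_def)
  have X: "X \<in> I \<rightarrow> space M" and Y: "Y \<in> I \<rightarrow> space M"
    using x Z by (auto simp: X_def Y_def I_def Pi_iff)
  have w_add: "w (i, True) + w (i, False) = ennreal (\<mu> i)" if "i \<in> {1..N}" for i
    using that \<mu>(1) q by (simp add: w_def algebra_simps mult_left_le flip: ennreal_plus)
  have "(\<Sum>p\<in>I. w p) = (\<Sum>i\<in>{1..N}. ennreal (\<mu> i))"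
    unfolding I_def sum_Times_UNIV_bool by (intro sum.cong refl w_add)
  also have "\<dots> = 1"
    using \<mu> by (subst sum_ennreal) (simp_all only: ennreal_1)
  finally have w: "(\<Sum>p\<in>I. w p) = 1" .
  \<comment> \<open>\<open>Y\<close> ignores the flag, so the two parts of each atom merge to its
    full weight again.\<close>
  have Q: "empirical M N \<mu> Z = distr (point_measure I w) M Y"
  proof (rule measure_eqI)
    fix A assume "A \<in> sets (empirical M N \<mu> Z)"
    then have A: "A \<in> sets M" by simp
    have "emeasure (distr (point_measure I w) M Y) A =
        (\<integral>\<^sup>+ z. indicator A z \<partial>distr (point_measure I w) M Y)"
      using A by simp
    also have "\<dots> = (\<Sum>p\<in>I. w p * indicator A (Y p))"
      using A by (intro nn_integral_distr_point_measure[OF I Y]) simp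
    also have "\<dots> = (\<Sum>i\<in>{1..N}. ennreal (\<mu> i) * indicator A (Z i))"
      unfolding I_def sum_Times_UNIV_bool
      by (intro sum.cong refl) (simp add: Y_def w_add flip: distrib_right)
    finally show "emeasure (empirical M N \<mu> Z) A = emeasure (distr (point_measure I w) M Y) A"
      using A by (simp add: emeasure_empirical)
  qed simp
  have "(\<Sum>p\<in>I. w p * ennreal_powr (d (X p) (Y p)) r) = (\<Sum>i\<in>{1..N}. ennreal (\<mu> i * q i * D i powr r))"
    unfolding I_def sum_Times_UNIV_bool
  proof (intro sum.cong refl)
    fix i assume i: "i \<in> {1..N}"
    then have "Z i \<in> space M"
      using Z by blast
    \<comment> \<open>The part that stays costs nothing, as d(z, z) = 0.\<close>
    then have "d (Z i) (Z i) = 0"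
      using d by (simp add: cost_function_def)
    then have "ennreal_powr (d (Z i) (Z i)) r = 0"
      by (simp add: ennreal_powr_def)
    then show "w (i, True) * ennreal_powr (d (X (i, True)) (Y (i, True))) r +
        w (i, False) * ennreal_powr (d (X (i, False)) (Y (i, False))) r = ennreal (\<mu> i * q i * D i powr r)"
      using i \<mu>(1) q D by (simp add: w_def X_def Y_def ennreal_powr_ennreal ennreal_mult)
  qed
  also have "\<dots> = ennreal (\<Sum>i\<in>{1..N}. \<mu> i * q i * D i powr r)"
    using \<mu>(1) q by (intro sum_ennreal) auto
  also have "\<dots> \<le> ennreal (\<delta> powr r)"
    using cost by (rule ennreal_leI)
  finally have "ennreal_powr (\<Sum>p\<in>I. w p * ennreal_powr (d (X p) (Y p)) r) (1 / r) \<le> ennreal \<delta>"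
    using ennreal_powr_mono[of _ _ "1 / r"] r \<delta> by (fastforce simp: ennreal_powr_ennreal powr_powr)
  then have "wasserstein d r P (empirical M N \<mu> Z) \<le> ennreal \<delta>"
    unfolding P_def Q by (rule order_trans[OF wasserstein_distr_point_measure_le[OF I X Y w d r]])
  moreover have "ennreal (\<Sum>i\<in>{1..N}. \<mu> i * q i * g (x i)) \<le> nn_expectation P g"
  proof -
    have "ennreal (\<Sum>i\<in>{1..N}. \<mu> i * q i * g (x i)) = (\<Sum>i\<in>{1..N}. ennreal (\<mu> i * q i * g (x i)))"
      using \<mu>(1) q g(2) x by (intro sum_ennreal[symmetric] mult_nonneg_nonneg) (auto simp: Pi_iff)
    \<comment> \<open>Drops the nonnegative contribution of the mass that stays.\<close>
    also have "\<dots> \<le> (\<Sum>p\<in>I. w p * ennreal (g (X p)))"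
      unfolding I_def sum_Times_UNIV_bool
    proof (rule sum_mono)
      fix i assume "i \<in> {1..N}"
      then have "ennreal (\<mu> i * q i * g (x i)) = w (i, True) * ennreal (g (X (i, True)))"
        using \<mu>(1) q by (simp add: w_def X_def ennreal_mult')
      then show "ennreal (\<mu> i * q i * g (x i)) \<le>
          w (i, True) * ennreal (g (X (i, True))) + w (i, False) * ennreal (g (X (i, False)))"
        by simp
    qed
    also have "\<dots> = nn_expectation P g"
      unfolding nn_expectation_def P_def using g(1)
      by (subst nn_integral_distr_point_measure[OF I X]) auto
    finally show ?thesis .
  qed
  moreover have "P \<in> space (prob_algebra M)"
    unfolding P_def by (rule distr_point_measure_in_prob_algebra[OF I X w])
  ultimately show ?thesis by blast
qed

lemma nn_expectation_empirical:
  assumes "Z \<in> {1..N} \<rightarrow> space M" "\<And>i. i \<in> {1..N} \<Longrightarrow> 0 \<le> \<mu> i"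
    and "g \<in> borel_measurable M" "\<And>z. z \<in> space M \<Longrightarrow> 0 \<le> g z"
  shows "nn_expectation (empirical M N \<mu> Z) g = ennreal (\<Sum>i\<in>{1..N}. \<mu> i * g (Z i))"
proof -
  have "nn_expectation (empirical M N \<mu> Z) g = (\<Sum>i\<in>{1..N}. ennreal (\<mu> i) * ennreal (g (Z i)))"
    unfolding nn_expectation_def empirical_eq_distr[OF assms(1)]
    using assms(1,3) by (intro nn_integral_distr_point_measure) auto
  also have "\<dots> = (\<Sum>i\<in>{1..N}. ennreal (\<mu> i * g (Z i)))"
    using assms(2) by (intro sum.cong refl) (simp add: ennreal_mult')
  also have "\<dots> = ennreal (\<Sum>i\<in>{1..N}. \<mu> i * g (Z i))"
    using assms by (intro sum_ennreal mult_nonneg_nonneg) (auto simp: Pi_iff)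
  finally show ?thesis .
qed

text \<open>Here \<open>K\<close> stands for L - \<epsilon>, with the slack \<epsilon> of the growth
  condition fixed. The two cases of \<open>growth_distances\<close> call for different transport
  plans.\<close>

lemma ex_wasserstein_le_nn_expectation_ge:
  fixes M :: "'a measure" and N :: nat and \<mu> :: "nat \<Rightarrow> real" and Z :: "nat \<Rightarrow> 'a"
    and f :: "'a \<Rightarrow> real" and r :: real
  defines "E \<equiv> nn_expectation (empirical M N \<mu> Z) (\<lambda>z. f z powr r)"
  assumes Z: "Z \<in> {1..N} \<rightarrow> space M"
    and \<mu>: "\<And>i. i \<in> {1..N} \<Longrightarrow> 0 \<le> \<mu> i" "(\<Sum>i\<in>{1..N}. \<mu> i) = 1"
    and d: "cost_function M d" and r: "1 \<le> r" and \<delta>: "0 < \<delta>" and K: "0 < K"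
    and f: "\<And>z. z \<in> space M \<Longrightarrow> 0 \<le> f z" "(\<lambda>z. f z powr r) \<in> borel_measurable M"
    and growth: "\<And>i. i \<in> {1..N} \<Longrightarrow> \<exists>z'\<in>space M.
      d z' (Z i) \<in> growth_distances E r \<delta> f (Z i) \<and>
      f z' - f (Z i) \<ge> K * enn2real (d z' (Z i))"
  shows "\<exists>P\<in>space (prob_algebra M). wasserstein d r P (empirical M N \<mu> Z) \<le> ennreal \<delta> \<and>
    ennreal_powr (ennreal_powr E (1 / r) + ennreal (K * \<delta>)) r \<le>
      nn_expectation P (\<lambda>z. f z powr r)"
proof -
  define e where "e = (\<Sum>i\<in>{1..N}. \<mu> i * f (Z i) powr r)"
  have e0: "0 \<le> e"
    unfolding e_def using \<mu>(1) by (intro sum_nonneg) auto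
  have E: "E = ennreal e"
    unfolding E_def e_def using Z \<mu> f(2) by (intro nn_expectation_empirical) auto
  have goal: "ennreal_powr (ennreal_powr E (1 / r) + ennreal (K * \<delta>)) r =
      ennreal ((e powr (1 / r) + K * \<delta>) powr r)"
    using e0 K \<delta> by (simp add: E ennreal_powr_ennreal flip: ennreal_plus)
  obtain x where x: "\<And>i. i \<in> {1..N} \<Longrightarrow> x i \<in> space M"
    "\<And>i. i \<in> {1..N} \<Longrightarrow> d (x i) (Z i) \<in> growth_distances (ennreal e) r \<delta> f (Z i)"
    "\<And>i. i \<in> {1..N} \<Longrightarrow> f (x i) - f (Z i) \<ge> K * enn2real (d (x i) (Z i))"
    using growth unfolding E by metis
  have f_Z: "0 \<le> f (Z i)" if "i \<in> {1..N}" for i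
    using that Z f(1) by blast
  define D where "D i = enn2real (d (x i) (Z i))" for i
  have D0: "0 \<le> D i" for i
    by (simp add: D_def)
  have f_x: "f (Z i) + K * D i \<le> f (x i)" if "i \<in> {1..N}" for i
    using x(3)[OF that] by (simp add: D_def)
  have x': "x \<in> {1..N} \<rightarrow> space M"
    using x(1) by blast
  show ?thesis
  proof (cases "e = 0")
    case True
    \<comment> \<open>The interval in \<open>growth_distances\<close> excludes infinity, so
      \<open>enn2real\<close> loses nothing.\<close>
    have D: "\<delta> \<le> D i" "d (x i) (Z i) = ennreal (D i)" if "i \<in> {1..N}" for i
      using x(2)[OF that] \<delta> True
      by (cases "d (x i) (Z i)"; simp add: growth_distances_def D_def)+
    define q where "q i = (\<delta> / D i) powr r" for i
    \<comment> \<open>The fractions make every atom contribute \<delta>^r per unit of weight,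
      whatever its distance; they are at most 1 because \<open>D i\<close> is at least
      \<delta>.\<close>
    have q: "0 \<le> q i" "q i \<le> 1" "q i * D i powr r = \<delta> powr r" if "i \<in> {1..N}" for i
      using D(1)[OF that] \<delta> r by (auto simp: q_def powr_divide powr_le_one_le intro!: powr_mono2)
    have "(\<Sum>i\<in>{1..N}. \<mu> i * q i * D i powr r) = (\<Sum>i\<in>{1..N}. \<mu> i * \<delta> powr r)"
      by (intro sum.cong refl) (simp add: q(3) mult.assoc)
    also have "\<dots> = \<delta> powr r"
      unfolding sum_distrib_right[symmetric] \<mu>(2) by simp
    finally have cost: "(\<Sum>i\<in>{1..N}. \<mu> i * q i * D i powr r) = \<delta> powr r" .
    \<comment> \<open>Since f(Z_i) \<ge> 0, growth gives f(x_i) \<ge> K D_i, and the same fractions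
      turn the sum of (K D_i)^r into (K \<delta>)^r.\<close>
    have "(K * \<delta>) powr r = (\<Sum>i\<in>{1..N}. \<mu> i * q i * D i powr r) * K powr r"
      unfolding cost using K \<delta> by (simp add: powr_mult)
    also have "\<dots> = (\<Sum>i\<in>{1..N}. \<mu> i * q i * (K * D i) powr r)"
      unfolding sum_distrib_right using K D0 by (simp add: powr_mult mult_ac)
    also have "\<dots> \<le> (\<Sum>i\<in>{1..N}. \<mu> i * q i * f (x i) powr r)"
    proof (intro sum_mono mult_left_mono powr_mono2)
      fix i assume i: "i \<in> {1..N}"
      show "K * D i \<le> f (x i)"
        using f_x[OF i] f_Z[OF i] by simp
    qed (use K D0 r \<mu>(1) q in auto)
    finally have le: "ennreal ((K * \<delta>) powr r) \<le> ennreal (\<Sum>i\<in>{1..N}. \<mu> i * q i * f (x i) powr r)"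
      by (rule ennreal_leI)
    have "\<exists>P\<in>space (prob_algebra M). wasserstein d r P (empirical M N \<mu> Z) \<le> ennreal \<delta> \<and>
        ennreal (\<Sum>i\<in>{1..N}. \<mu> i * q i * f (x i) powr r) \<le> nn_expectation P (\<lambda>z. f z powr r)"
      using r \<delta> cost f D0 by (intro ex_wasserstein_empirical_le[OF Z x' \<mu> q(1,2) _ D(2) d]) auto
    with le show ?thesis
      unfolding goal using True by (auto intro: order_trans)
  next
    case False
    then have e: "0 < e" using e0 by simp
    define s where "s = e powr (1 / r)"
    have s: "0 < s" "s powr r = e"
      using e r by (auto simp: s_def powr_powr)
    have D: "D i = f (Z i) / s * \<delta>" "d (x i) (Z i) = ennreal (D i)" if "i \<in> {1..N}" for i
    proof -
      have "d (x i) (Z i) = ennreal (f (Z i) / s) * ennreal \<delta>"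
        using x(2)[OF that] e s f_Z[OF that]
        by (simp add: growth_distances_def ennreal_powr_ennreal divide_ennreal flip: s_def)
      also have "\<dots> = ennreal (f (Z i) / s * \<delta>)"
        using \<delta> by (intro ennreal_mult''[symmetric]) simp
      finally have "d (x i) (Z i) = ennreal (f (Z i) / s * \<delta>)" .
      then show "D i = f (Z i) / s * \<delta>" "d (x i) (Z i) = ennreal (D i)"
        using s \<delta> f_Z[OF that] by (simp_all add: D_def)
    qed
    \<comment> \<open>The factor 1 is the moved fraction \<open>q i\<close>: here all the mass
      moves.\<close>
    have "(\<Sum>i\<in>{1..N}. \<mu> i * 1 * D i powr r) = (\<Sum>i\<in>{1..N}. \<mu> i * f (Z i) powr r * (\<delta> powr r / e))"
      using s \<delta> f_Z by (intro sum.cong refl) (simp add: D powr_mult powr_divide)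
    also have "\<dots> = \<delta> powr r"
      unfolding sum_distrib_right[symmetric] e_def[symmetric] using e by simp
    finally have cost: "(\<Sum>i\<in>{1..N}. \<mu> i * 1 * D i powr r) = \<delta> powr r" .
    \<comment> \<open>As \<open>D i\<close> is proportional to f(Z_i), the bound f(Z_i) + K D_i
      equals f(Z_i) (s + K \<delta>) / s. The common factor leaves the sum, which is
      \<open>e\<close>.\<close>
    have "(s + K * \<delta>) powr r = e * ((s + K * \<delta>) / s) powr r"
      using s e K \<delta> by (simp add: powr_divide)
    also have "\<dots> = (\<Sum>i\<in>{1..N}. \<mu> i * 1 * (f (Z i) * ((s + K * \<delta>) / s)) powr r)"
      unfolding e_def sum_distrib_right using s K \<delta> f_Z
      by (intro sum.cong refl) (simp add: powr_mult powr_divide)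
    also have "\<dots> \<le> (\<Sum>i\<in>{1..N}. \<mu> i * 1 * f (x i) powr r)"
    proof (intro sum_mono mult_left_mono powr_mono2)
      fix i assume i: "i \<in> {1..N}"
      have "f (Z i) * ((s + K * \<delta>) / s) = f (Z i) + K * D i"
        using s by (simp add: D(1)[OF i] field_simps)
      then show "f (Z i) * ((s + K * \<delta>) / s) \<le> f (x i)"
        using f_x[OF i] by simp
    qed (use K s \<delta> r \<mu>(1) f_Z in auto)
    finally have le: "ennreal ((s + K * \<delta>) powr r) \<le> ennreal (\<Sum>i\<in>{1..N}. \<mu> i * 1 * f (x i) powr r)"
      by (rule ennreal_leI)
    have "\<exists>P\<in>space (prob_algebra M). wasserstein d r P (empirical M N \<mu> Z) \<le> ennreal \<delta> \<and>
        ennreal (\<Sum>i\<in>{1..N}. \<mu> i * 1 * f (x i) powr r) \<le> nn_expectation P (\<lambda>z. f z powr r)"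
      using r \<delta> cost f D0
      by (intro ex_wasserstein_empirical_le[OF Z x' \<mu> zero_le_one order_refl _ D(2) d]) auto
    with le show ?thesis
      unfolding goal s_def by (auto intro: order_trans)
  qed
qed

section \<open>The worst-case expectation from both bounds\<close>

theorem theorem3p3:
  fixes M :: "'a measure" and N :: nat and Z :: "nat \<Rightarrow> 'a" and \<mu> :: "nat \<Rightarrow> real"
    and d :: "'a \<Rightarrow> 'a \<Rightarrow> ennreal" and \<delta> r L :: real
    and B :: "'b set" and \<beta> :: 'b
    and loss :: "'a \<Rightarrow> 'b \<Rightarrow> real" and \<psi> :: "'b \<Rightarrow> 'a \<Rightarrow> real"
  assumes singletons: "\<And>z. z \<in> space M \<Longrightarrow> {z} \<in> sets M"
    and loss_measurable: "\<And>b. b \<in> B \<Longrightarrow> (\<lambda>z. loss z b) \<in> borel_measurable M"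
    and data: "\<And>i. i \<in> {1..N} \<Longrightarrow> Z i \<in> space M"
    and weights_nonneg: "\<And>i. i \<in> {1..N} \<Longrightarrow> 0 \<le> \<mu> i"
    and weights_sum: "(\<Sum>i\<in>{1..N}. \<mu> i) = 1"
    and cost: "cost_function M d"
    and delta: "0 < \<delta>"
    and r: "1 < r"
    and loss_form: "\<And>b z. b \<in> B \<Longrightarrow> z \<in> space M \<Longrightarrow> loss z b = \<psi> b z powr r"
    and beta: "\<beta> \<in> B"
    and psi_nonneg: "\<And>z. z \<in> space M \<Longrightarrow> 0 \<le> \<psi> \<beta> z"
    and L_pos: "0 < L"
    and A1: "lipschitz_at M L d (Z ` {1..N}) (\<psi> \<beta>)"
    and growth: "\<And>\<epsilon> i. 0 < \<epsilon> \<Longrightarrow> \<epsilon> < L \<Longrightarrow> i \<in> {1..N} \<Longrightarrow>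
      \<exists>z'\<in>space M.
        d z' (Z i) \<in> growth_distances (nn_expectation (empirical M N \<mu> Z) (\<lambda>z. loss z \<beta>)) r \<delta> (\<psi> \<beta>) (Z i) \<and>
        \<psi> \<beta> z' - \<psi> \<beta> (Z i) \<ge> (L - \<epsilon>) * enn2real (d z' (Z i))"
  shows "(SUP P\<in>{P \<in> space (prob_algebra M). wasserstein d r P (empirical M N \<mu> Z) \<le> ennreal \<delta>}.
           nn_expectation P (\<lambda>z. loss z \<beta>)) =
    ennreal_powr
      (ennreal_powr (nn_expectation (empirical M N \<mu> Z) (\<lambda>z. loss z \<beta>)) (1 / r) + ennreal (L * \<delta>)) r"
proof -
  let ?f = "\<lambda>z. \<psi> \<beta> z powr r" and ?Q = "empirical M N \<mu> Z"
  have Z: "Z \<in> {1..N} \<rightarrow> space M"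
    using data by blast
  \<comment> \<open>The loss agrees with \<psi>^r only on the space of \<open>M\<close>, hence the
    restriction to measures with the same sigma-algebra.\<close>
  have expectation_loss: "nn_expectation P (\<lambda>z. loss z \<beta>) = nn_expectation P ?f"
    if "sets P = sets M" for P
    using sets_eq_imp_space_eq[OF that] loss_form[OF beta]
    by (auto simp: nn_expectation_def intro!: nn_integral_cong)
  have meas: "?f \<in> borel_measurable M"
    using loss_measurable[OF beta] loss_form[OF beta] by (simp cong: measurable_cong)
  define e where "e = (\<Sum>i\<in>{1..N}. \<mu> i * ?f (Z i))"
  have E: "nn_expectation ?Q (\<lambda>z. loss z \<beta>) = ennreal e"
    unfolding expectation_loss[OF sets_empirical] e_def
    using Z weights_nonneg meas by (intro nn_expectation_empirical) auto
  have e0: "0 \<le> e"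
    unfolding e_def using weights_nonneg by (intro sum_nonneg) auto
  let ?S = "SUP P\<in>{P \<in> space (prob_algebra M). wasserstein d r P ?Q \<le> ennreal \<delta>}. nn_expectation P (\<lambda>z. loss z \<beta>)"
  have lower: "ennreal ((e powr (1 / r) + (L - \<epsilon>) * \<delta>) powr r) \<le> ?S" if \<epsilon>: "0 < \<epsilon>" "\<epsilon> < L" for \<epsilon>
  proof -
    obtain P where P: "P \<in> space (prob_algebra M)" "wasserstein d r P ?Q \<le> ennreal \<delta>"
      "ennreal_powr (ennreal_powr (nn_expectation ?Q ?f) (1 / r) + ennreal ((L - \<epsilon>) * \<delta>)) r \<le> nn_expectation P ?f"
      using ex_wasserstein_le_nn_expectation_ge[of Z N M \<mu> d r \<delta> "L - \<epsilon>" "\<psi> \<beta>"]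
        Z weights_nonneg weights_sum cost r delta \<epsilon> psi_nonneg meas growth[OF \<epsilon>]
      by (auto simp: expectation_loss)
    have "ennreal ((e powr (1 / r) + (L - \<epsilon>) * \<delta>) powr r) \<le> nn_expectation P (\<lambda>z. loss z \<beta>)"
      using P(1,3) E e0 \<epsilon> delta
      by (simp add: expectation_loss space_prob_algebra ennreal_powr_ennreal flip: ennreal_plus)
    also have "\<dots> \<le> ?S"
      using P(1,2) by (intro SUP_upper) auto
    finally show ?thesis .
  qed
  \<comment> \<open>The lower bound holds for each \<epsilon> strictly between 0 and
    \<open>L\<close>; the full constant \<open>L\<close> is reached in the limit from the right at
    0.\<close>
  have "((\<lambda>\<epsilon>. ennreal ((e powr (1 / r) + (L - \<epsilon>) * \<delta>) powr r)) \<longlongrightarrow>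
      ennreal ((e powr (1 / r) + (L - 0) * \<delta>) powr r)) (at_right 0)"
    using r L_pos delta
    by (intro tendsto_intros tendsto_powr') (auto simp: eventually_at_right_field intro!: exI[of _ L])
  then have "ennreal ((e powr (1 / r) + (L - 0) * \<delta>) powr r) \<le> ?S"
    by (rule tendsto_upperbound)
      (use L_pos in \<open>auto simp: eventually_at_right_field lower intro!: exI[of _ L]\<close>)
  moreover have "?S \<le> ennreal_powr
      (ennreal_powr (nn_expectation ?Q (\<lambda>z. loss z \<beta>)) (1 / r) + ennreal (L * \<delta>)) r"
  proof (rule SUP_least)
    fix P assume "P \<in> {P \<in> space (prob_algebra M). wasserstein d r P ?Q \<le> ennreal \<delta>}"
    then have P: "sets P = sets M" "wasserstein d r P ?Q \<le> ennreal \<delta>"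
      by (auto simp: space_prob_algebra)
    show "nn_expectation P (\<lambda>z. loss z \<beta>) \<le> ennreal_powr
        (ennreal_powr (nn_expectation ?Q (\<lambda>z. loss z \<beta>)) (1 / r) + ennreal (L * \<delta>)) r"
      unfolding expectation_loss[OF P(1)] expectation_loss[OF sets_empirical]
      using r delta
      by (intro nn_expectation_le_of_wasserstein_le[OF P(1) sets_empirical cost psi_nonneg meas _ L_pos
            AE_empirical_in_image[OF singletons Z] A1 _ P(2)]) auto
  qed
  ultimately show ?thesis
    using e0 L_pos delta by (intro antisym) (simp_all add: E ennreal_powr_ennreal flip: ennreal_plus)
qed

end
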